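(* Let $\Gamma$ be a weighted digraph on vertex set $\{1,\dots,n\}$ ($n>1$) with Kirchhoff matrix $L(\Gamma)$, and consider any finite stationary Markov chain with state set $\{1,\dots,n\}$ and transition probability matrix $P$ that is related to $\Gamma$, i.e. $P=I-\alpha L(\Gamma)$ for some $\alpha\neq 0$. Then the limiting matrix of average probabilities $B=\lim_{k\to\infty}\frac1k\sum_{t=0}^{k-1}P^t$ of this chain coincides with $\bar J$, the normalized matrix of maximum out forests of $\Gamma$.
   Context: A weighted digraph $\Gamma$ has no loops, vertex set $V(\Gamma)=\{1,\dots,n\}$, and each arc $(i,j)$ carries a weight $\varepsilon_{ij}>0$; $\varepsilon_{ij}=0$ iff $(i,j)$ is not an arc. The weight of a subgraph is the product of the weights of its arcs (1 if it has no arcs); the weight $\varepsilon(\mathcal G)$ of a set of subgraphs is the sum of their weights (0 for the empty set). The Kirchhoff matrix $L=(\ell_{ij})$ has $\ell_{ij}=-\varepsilon_{ji}$ for $j\ne i$ and $\ell_{ii}=\sum_{k\ne i}\varepsilon_{ki}$. A diverging forest is a digraph without circuits in which every vertex has indegree at most 1; its roots are the vertices of indegree 0, its weak components are trees diverging from the roots. A spanning diverging forest of $\Gamma$ is a spanning subgraph of $\Gamma$ that is a diverging forest; a maximum out forest is a spanning diverging forest with the largest possible number of arcs. The forest dimension $v$ is the number of roots (trees) of a maximum out forest, so maximum out forests have $n-v$ arcs. $\mathcal F_k$ is the set of spanning diverging forests of $\Gamma$ with $k$ arcs, and $\mathcal F_k^{j\to i}$ the set of those in which $i$ belongs to the tree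 whose root is $j$. The matrix of maximum out forests is $Q_{n-v}=(q_{ij})$ with $q_{ij}=\varepsilon(\mathcal F^{j\to i}_{n-v})$, and $\bar J=Q_{n-v}/\varepsilon(\mathcal F_{n-v})$. (The Cesàro limit $B$ exists for every finite stationary Markov chain.) *)

theory Defs
  imports "HOL-Analysis.Analysis"
begin

text \<open>
  The vertex set is an arbitrary finite type. A weighted digraph is given by its weight
  function; \<open>w i j\<close> is the weight of the arc from \<open>i\<close> to \<open>j\<close>, and \<open>w i j = 0\<close> means that
  there is no such arc.
\<close>

definition arcs :: "('n \<Rightarrow> 'n \<Rightarrow> real) \<Rightarrow> ('n \<times> 'n) set" where
  "arcs w = {(i, j). w i j \<noteq> 0}"

definition weighted_digraph :: "('n \<Rightarrow> 'n \<Rightarrow> real) \<Rightarrow> bool" where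
  "weighted_digraph w \<longleftrightarrow> (\<forall>(i, j) \<in> arcs w. w i j > 0) \<and> (\<forall>i. (i, i) \<notin> arcs w)"

definition kirchhoff_matrix :: "('n::finite \<Rightarrow> 'n \<Rightarrow> real) \<Rightarrow> real ^ 'n ^ 'n" where
  "kirchhoff_matrix w = (\<chi> i j. if i = j then (\<Sum>k \<in> UNIV - {i}. w k i) else - w j i)"

text \<open>A spanning subgraph has all the vertices, so it is represented by its set of arcs.\<close>

definition indegree :: "('n \<times> 'n) set \<Rightarrow> 'n \<Rightarrow> nat" where
  "indegree F i = card {k. (k, i) \<in> F}"

definition roots :: "('n \<times> 'n) set \<Rightarrow> 'n set" where
  "roots F = {i. indegree F i = 0}"

definition weak_component :: "('n \<times> 'n) set \<Rightarrow> 'n \<Rightarrow> 'n set" where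
  "weak_component F i = (F \<union> F\<inverse>)\<^sup>* `` {i}"

definition diverging_forest :: "('n \<times> 'n) set \<Rightarrow> bool" where
  "diverging_forest F \<longleftrightarrow> acyclic F \<and> (\<forall>i. indegree F i \<le> 1)"

definition spanning_diverging_forests :: "('n \<Rightarrow> 'n \<Rightarrow> real) \<Rightarrow> ('n \<times> 'n) set set" where
  "spanning_diverging_forests w = {F. F \<subseteq> arcs w \<and> diverging_forest F}"

definition maximum_out_forests :: "('n \<Rightarrow> 'n \<Rightarrow> real) \<Rightarrow> ('n \<times> 'n) set set" where
  "maximum_out_forests w =
     {F \<in> spanning_diverging_forests w. \<forall>F' \<in> spanning_diverging_forests w. card F' \<le> card F}"

text \<open>Well-definedness is lemma \<open>forest_dimension_eq\<close> below.\<close>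

definition forest_dimension :: "('n \<Rightarrow> 'n \<Rightarrow> real) \<Rightarrow> nat" where
  "forest_dimension w = (THE v. \<exists>F \<in> maximum_out_forests w. card (roots F) = v)"

definition forests :: "('n \<Rightarrow> 'n \<Rightarrow> real) \<Rightarrow> nat \<Rightarrow> ('n \<times> 'n) set set" where
  "forests w k = {F \<in> spanning_diverging_forests w. card F = k}"

definition forests_to :: "('n \<Rightarrow> 'n \<Rightarrow> real) \<Rightarrow> nat \<Rightarrow> 'n \<Rightarrow> 'n \<Rightarrow> ('n \<times> 'n) set set" where
  "forests_to w k j i = {F \<in> forests w k. j \<in> roots F \<and> i \<in> weak_component F j}"

definition subgraph_weight :: "('n \<Rightarrow> 'n \<Rightarrow> real) \<Rightarrow> ('n \<times> 'n) set \<Rightarrow> real" where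
  "subgraph_weight w F = (\<Prod>(i, j) \<in> F. w i j)"

definition set_weight :: "('n \<Rightarrow> 'n \<Rightarrow> real) \<Rightarrow> ('n \<times> 'n) set set \<Rightarrow> real" where
  "set_weight w G = (\<Sum>F \<in> G. subgraph_weight w F)"

definition forest_matrix :: "('n::finite \<Rightarrow> 'n \<Rightarrow> real) \<Rightarrow> nat \<Rightarrow> real ^ 'n ^ 'n" where
  "forest_matrix w k = (\<chi> i j. set_weight w (forests_to w k j i))"

definition normalized_max_forest_matrix :: "('n::finite \<Rightarrow> 'n \<Rightarrow> real) \<Rightarrow> real ^ 'n ^ 'n" where
  "normalized_max_forest_matrix w =
     (let m = CARD('n) - forest_dimension w
      in (1 / set_weight w (forests w m)) *\<^sub>R forest_matrix w m)"

definition stochastic_matrix :: "real ^ 'n ^ 'n::finite \<Rightarrow> bool" where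
  "stochastic_matrix P \<longleftrightarrow> (\<forall>i j. P $ i $ j \<ge> 0) \<and> (\<forall>i. (\<Sum>j \<in> UNIV. P $ i $ j) = 1)"

text \<open>Matrix power; the operation \<open>(^)\<close> on \<open>real ^ 'n ^ 'n\<close> is componentwise.\<close>

primrec matrix_power :: "real ^ 'n ^ 'n \<Rightarrow> nat \<Rightarrow> real ^ 'n ^ 'n::finite" where
  "matrix_power A 0 = mat 1"
| "matrix_power A (Suc k) = A ** matrix_power A k"

definition cesaro_mean :: "real ^ 'n ^ 'n \<Rightarrow> nat \<Rightarrow> real ^ 'n ^ 'n::finite" where
  "cesaro_mean P k = (1 / real k) *\<^sub>R (\<Sum>t<k. matrix_power P t)"

lemma card_roots_plus_card:
  fixes F :: "('n::finite \<times> 'n) set"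
  assumes "diverging_forest F"
  shows "card (roots F) + card F = CARD('n)"
proof -
  have inj: "inj_on snd F"
  proof (rule inj_onI, clarsimp)
    fix a b c assume "(a, c) \<in> F" "(b, c) \<in> F"
    moreover have "card {k. (k, c) \<in> F} \<le> Suc 0"
      using assms by (simp add: diverging_forest_def indegree_def)
    ultimately show "a = b"
      by (auto simp: card_le_Suc0_iff_eq)
  qed
  have img: "snd ` F = - roots F"
    by (force simp: roots_def indegree_def)
  have "card F = card (- roots F)"
    using card_image[OF inj] img by simp
  moreover have "card (- roots F) = CARD('n) - card (roots F)"
    by (simp add: Compl_eq_Diff_UNIV card_Diff_subset)
  moreover have "card (roots F) \<le> CARD('n)"
    by (rule card_mono) auto
  ultimately show ?thesis
    by linarith
qed

lemma maximum_out_forests_nonempty: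
  fixes w :: "'n::finite \<Rightarrow> 'n \<Rightarrow> real"
  shows "maximum_out_forests w \<noteq> {}"
proof -
  let ?S = "spanning_diverging_forests w"
  have "{} \<in> ?S"
    by (simp add: spanning_diverging_forests_def diverging_forest_def acyclic_def indegree_def)
  then have "Max (card ` ?S) \<in> card ` ?S"
    by (intro Max_in) auto
  then obtain F where "F \<in> ?S" "card F = Max (card ` ?S)"
    by force
  then have "F \<in> maximum_out_forests w"
    by (simp add: maximum_out_forests_def)
  then show ?thesis by blast
qed

lemma forest_dimension_eq:
  fixes w :: "'n::finite \<Rightarrow> 'n \<Rightarrow> real"
  assumes "F \<in> maximum_out_forests w"
  shows "card (roots F) = forest_dimension w"
proof -
  have eq: "card (roots G) = card (roots F)" if "G \<in> maximum_out_forests w" for G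
  proof -
    have "card G = card F"
      using that assms by (simp add: maximum_out_forests_def dual_order.antisym)
    moreover have "diverging_forest G" "diverging_forest F"
      using that assms by (simp_all add: maximum_out_forests_def spanning_diverging_forests_def)
    ultimately show ?thesis
      using card_roots_plus_card by (metis add_right_cancel)
  qed
  show ?thesis
    unfolding forest_dimension_def
    by (rule the_equality[symmetric]) (use assms eq in blast)+
qed

lemma forests_max:
  fixes w :: "'n::finite \<Rightarrow> 'n \<Rightarrow> real"
  shows "forests w (CARD('n) - forest_dimension w) = maximum_out_forests w"
proof -
  obtain M where M: "M \<in> maximum_out_forests w"
    using maximum_out_forests_nonempty by blast
  then have "card M = CARD('n) - forest_dimension w"
    using card_roots_plus_card[of M] forest_dimension_eq[OF M]
    by (simp add: maximum_out_forests_def spanning_diverging_forests_def)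
  moreover have "card M = card F" if "F \<in> maximum_out_forests w" for F
    using M that by (simp add: maximum_out_forests_def dual_order.antisym)
  ultimately show ?thesis
    using M by (auto simp: forests_def maximum_out_forests_def)
qed

end

theory Submission
  imports Defs
begin

text \<open>
  Write \<open>Q\<^sub>k\<close> for the matrix of forests with \<open>k\<close> arcs, \<open>\<sigma>\<^sub>k\<close> for their total weight and \<open>m\<close>
  for the number of arcs of a maximum out forest. A bijection on forests gives
  \<open>Q\<^sub>k\<^sub>+\<^sub>1 = \<sigma>\<^sub>k\<^sub>+\<^sub>1 I - L Q\<^sub>k\<close>. For \<open>k = m\<close> this says \<open>L Q\<^sub>m = 0\<close>, so that the normalized matrix
  \<open>J\<close> satisfies \<open>P J = J\<close>; for \<open>k = m - 1\<close> it says that \<open>J = I - L R\<close> for some \<open>R\<close>.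
  Since \<open>\<alpha> L = I - P\<close>, the sum of \<open>P\<^sup>t L\<close> over \<open>t < k\<close> telescopes to \<open>(I - P\<^sup>k) / \<alpha>\<close>, which is
  bounded, and hence the Cesaro means of \<open>P\<^sup>t = P\<^sup>t (J + L R) = J + P\<^sup>t L R\<close> tend to \<open>J\<close>.
\<close>

section \<open>Bilinearity of the matrix product\<close>

lemma matrix_mult_add_left:
  fixes A B :: "real ^ 'm ^ 'n"
  shows "(A + B) ** C = A ** C + B ** C"
  by (simp add: vec_eq_iff matrix_matrix_mult_def distrib_right sum.distrib)

lemma matrix_mult_diff_left:
  fixes A B :: "real ^ 'm ^ 'n"
  shows "(A - B) ** C = A ** C - B ** C"
  by (simp add: vec_eq_iff matrix_matrix_mult_def left_diff_distrib sum_subtractf)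

lemma matrix_mult_diff_right:
  fixes A :: "real ^ 'm ^ 'n"
  shows "A ** (B - C) = A ** B - A ** C"
  by (simp add: vec_eq_iff matrix_matrix_mult_def right_diff_distrib sum_subtractf)

lemma matrix_mult_scaleR_left:
  fixes A :: "real ^ 'm ^ 'n"
  shows "(c *\<^sub>R A) ** B = c *\<^sub>R (A ** B)"
  by (simp add: scalar_matrix_assoc)

lemma matrix_mult_scaleR_right:
  fixes A :: "real ^ 'm ^ 'n"
  shows "A ** (c *\<^sub>R B) = c *\<^sub>R (A ** B)"
  by (simp add: matrix_scalar_ac scalar_matrix_assoc)

section \<open>Diverging forests\<close>

lemma roots_iff:
  fixes F :: "('n::finite \<times> 'n) set"
  shows "i \<in> roots F \<longleftrightarrow> (\<forall>k. (k, i) \<notin> F)"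
  by (auto simp: roots_def indegree_def)

lemma diverging_forest_iff:
  fixes F :: "('n::finite \<times> 'n) set"
  shows "diverging_forest F \<longleftrightarrow> acyclic F \<and> (\<forall>x y z. (x, z) \<in> F \<longrightarrow> (y, z) \<in> F \<longrightarrow> x = y)"
  by (auto simp: diverging_forest_def indegree_def card_le_Suc0_iff_eq)

lemma diverging_forest_parent_unique:
  fixes F :: "('n::finite \<times> 'n) set"
  assumes "diverging_forest F" "(x, z) \<in> F" "(y, z) \<in> F"
  shows "x = y"
  using assms by (auto simp: diverging_forest_iff)

text \<open>No arc enters a root, so the path from \<open>j\<close> to \<open>x\<close> is
  nontrivial, and its last arc must be the only arc into \<open>x\<close>, the one from
  \<open>y\<close>.\<close>

lemma reachable_from_root_parent:
  fixes F :: "('n::finite \<times> 'n) set"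
  assumes F: "diverging_forest F" and j: "j \<in> roots F"
    and jx: "(j, x) \<in> F\<^sup>*" and yx: "(y, x) \<in> F"
  shows "(j, y) \<in> F\<^sup>*"
  using jx
proof (cases rule: rtranclE)
  case base
  then show ?thesis using j yx by (auto simp: roots_iff)
next
  case (step z)
  then show ?thesis using diverging_forest_parent_unique[OF F _ yx] by blast
qed

text \<open>Reduces the undirected notion of a tree to directed reachability: a walk that starts at
  a root and traverses an arc backwards only returns to a parent, which is reachable too.\<close>

lemma weak_component_root:
  fixes F :: "('n::finite \<times> 'n) set"
  assumes F: "diverging_forest F" and j: "j \<in> roots F"
  shows "x \<in> weak_component F j \<longleftrightarrow> (j, x) \<in> F\<^sup>*"
proof
  assume "x \<in> weak_component F j"
  then have "(j, x) \<in> (F \<union> F\<inverse>)\<^sup>*" by (simp add: weak_component_def)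
  then show "(j, x) \<in> F\<^sup>*"
    by induction (auto intro: rtrancl_into_rtrancl reachable_from_root_parent[OF F j])
next
  assume "(j, x) \<in> F\<^sup>*"
  then show "x \<in> weak_component F j"
    by (simp add: weak_component_def in_rtrancl_UnI)
qed

lemma reachable_from_root_ancestor:
  fixes F :: "('n::finite \<times> 'n) set"
  assumes F: "diverging_forest F" and j: "j \<in> roots F"
    and "(y, x) \<in> F\<^sup>*" "(j, x) \<in> F\<^sup>*"
  shows "(j, y) \<in> F\<^sup>*"
  using assms(3,4)
  by (induction rule: converse_rtrancl_induct) (auto intro: reachable_from_root_parent[OF F j])

text \<open>One root is reachable from the other, and the path must be empty because no arc enters a
  root.\<close>

lemma root_unique:
  fixes F :: "('n::finite \<times> 'n) set"
  assumes F: "diverging_forest F" and "i \<in> roots F" "j \<in> roots F"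
    and "(i, x) \<in> F\<^sup>*" "(j, x) \<in> F\<^sup>*"
  shows "i = j"
proof -
  have "(j, i) \<in> F\<^sup>*"
    using reachable_from_root_ancestor[OF F] assms by blast
  then show ?thesis
    using assms(2) by (cases rule: rtranclE) (auto simp: roots_iff)
qed

text \<open>As no arc of \<open>G\<close> enters \<open>i\<close>, the new arc creates no second
  parent, and it can close a circuit only through a path from \<open>i\<close> to
  \<open>p\<close>.\<close>

lemma diverging_forest_insert_iff:
  fixes G :: "('n::finite \<times> 'n) set"
  assumes "i \<in> roots G"
  shows "diverging_forest (insert (p, i) G) \<longleftrightarrow> diverging_forest G \<and> (i, p) \<notin> G\<^sup>*"
  using assms by (auto simp: diverging_forest_iff acyclic_insert roots_iff)

lemma roots_insert:
  fixes G :: "('n::finite \<times> 'n) set"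
  shows "roots (insert (p, i) G) = roots G - {i}"
  by (auto simp: roots_iff)

text \<open>As a real-valued indicator it turns all entries of a forest matrix into sums over the
  same index set \<open>forests w k\<close>, so that products with the Kirchhoff matrix can be
  computed forest by forest.\<close>

definition rooted_at :: "('n \<times> 'n) set \<Rightarrow> 'n \<Rightarrow> 'n \<Rightarrow> real" where
  "rooted_at F x j = of_bool (j \<in> roots F \<and> (j, x) \<in> F\<^sup>*)"

lemma rooted_at_descendant_of_root:
  fixes F :: "('n::finite \<times> 'n) set"
  assumes "diverging_forest F" "i \<in> roots F" "(i, x) \<in> F\<^sup>*"
  shows "rooted_at F x j = of_bool (i = j)"
  using assms root_unique[OF assms(1)] by (auto simp: rooted_at_def)

text \<open>The new arc hangs the tree of \<open>i\<close> below \<open>p\<close>: the descendants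
  of \<open>i\<close> inherit the root of \<open>p\<close>, and every other vertex keeps its
  root.\<close>

lemma rooted_at_insert:
  fixes G :: "('n::finite \<times> 'n) set"
  assumes G: "diverging_forest G" and i: "i \<in> roots G" and p: "(i, p) \<notin> G\<^sup>*"
  shows "rooted_at (insert (p, i) G) x j =
    (if (i, x) \<in> G\<^sup>* then rooted_at G p j else rooted_at G x j)"
proof (cases "j = i")
  case True
  then show ?thesis using p by (simp add: rooted_at_def roots_insert)
next
  case False
  then show ?thesis
    using root_unique[OF G i, of j x] by (auto simp: rooted_at_def roots_insert rtrancl_insert)
qed

section \<open>The recurrence for forest matrices\<close>

lemma forests_iff:
  fixes w :: "'n::finite \<Rightarrow> 'n \<Rightarrow> real"
  shows "F \<in> forests w k \<longleftrightarrow> F \<subseteq> arcs w \<and> diverging_forest F \<and> card F = k"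
  by (auto simp: forests_def spanning_diverging_forests_def)

lemma set_weight_forests_to:
  fixes w :: "'n::finite \<Rightarrow> 'n \<Rightarrow> real"
  shows "set_weight w (forests_to w k j i) =
    (\<Sum>F\<in>forests w k. subgraph_weight w F * rooted_at F i j)"
proof -
  have "forests_to w k j i = forests w k \<inter> {F. j \<in> roots F \<and> (j, i) \<in> F\<^sup>*}"
    by (auto simp: forests_to_def forests_iff weak_component_root)
  then show ?thesis
    by (simp add: set_weight_def rooted_at_def sum.inter_restrict of_bool_def if_distrib cong: if_cong)
qed

lemma subgraph_weight_insert:
  fixes w :: "'n::finite \<Rightarrow> 'n \<Rightarrow> real"
  assumes "i \<in> roots G"
  shows "subgraph_weight w (insert (p, i) G) = w p i * subgraph_weight w G"
  using assms by (simp add: subgraph_weight_def roots_iff)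

text \<open>
  Deleting the arc into \<open>i\<close> turns a forest in which \<open>i\<close> is not a root into one in which it is.
\<close>

lemma sum_forests_split:
  fixes w :: "'n::finite \<Rightarrow> 'n \<Rightarrow> real" and f :: "('n \<times> 'n) set \<Rightarrow> real"
  defines "R \<equiv> \<lambda>i. {G. G \<subseteq> arcs w \<and> diverging_forest G \<and> i \<in> roots G}"
  shows "(\<Sum>F\<in>forests w k. subgraph_weight w F * f F) =
    (\<Sum>G\<in>{G \<in> R i. card G = k}. subgraph_weight w G * f G) +
    (\<Sum>G\<in>{G \<in> R i. Suc (card G) = k}. \<Sum>p | (i, p) \<notin> G\<^sup>*.
       w p i * subgraph_weight w G * f (insert (p, i) G))"
proof -
  let ?A = "{G \<in> R i. card G = k}"
  let ?B = "{F \<in> forests w k. i \<notin> roots F}"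
  let ?S = "{G \<in> R i. Suc (card G) = k}"
  let ?N = "\<lambda>G. {p. (i, p) \<notin> G\<^sup>* \<and> (p, i) \<in> arcs w}"
  let ?h = "\<lambda>(G, p). insert (p, i) G"
  have "forests w k = ?A \<union> ?B" "?A \<inter> ?B = {}"
    by (auto simp: forests_iff R_def)
  then have split: "(\<Sum>F\<in>forests w k. subgraph_weight w F * f F) =
    (\<Sum>G\<in>?A. subgraph_weight w G * f G) + (\<Sum>F\<in>?B. subgraph_weight w F * f F)"
    by (metis (no_types, lifting) finite sum.union_disjoint)
  have "bij_betw ?h (Sigma ?S ?N) ?B"
  proof (rule bij_betw_imageI)
    show "inj_on ?h (Sigma ?S ?N)"
    proof (rule inj_onI, clarify)
      fix G p H q
      assume "G \<in> R i" "H \<in> R i" and eq: "insert (p, i) G = insert (q, i) H"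
      then have no: "(k, i) \<notin> G" "(k, i) \<notin> H" for k
        by (auto simp: R_def roots_iff)
      then have "p = q" using eq by blast
      then show "G = H \<and> p = q" using eq no by (metis insert_ident)
    qed
    show "?h ` Sigma ?S ?N = ?B"
    proof (intro equalityI subsetI)
      fix F assume "F \<in> ?h ` Sigma ?S ?N"
      then obtain G p where F: "F = insert (p, i) G" and G: "G \<in> R i" "Suc (card G) = k"
        and p: "(i, p) \<notin> G\<^sup>*" "(p, i) \<in> arcs w"
        by auto
      have "(p, i) \<notin> G" using G by (auto simp: R_def roots_iff)
      then show "F \<in> ?B"
        using F G p by (auto simp: forests_iff R_def diverging_forest_insert_iff roots_insert)
    next
      fix F assume F: "F \<in> ?B"
      then obtain p where p: "(p, i) \<in> F" by (auto simp: roots_iff)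
      define G where "G = F - {(p, i)}"
      have FG: "F = insert (p, i) G" using p by (auto simp: G_def)
      have "k = p" if "(k, i) \<in> F" for k
        using F p that diverging_forest_parent_unique[of F k i p] by (simp add: forests_iff)
      then have "i \<in> roots G"
        by (auto simp: G_def roots_iff)
      moreover have "(p, i) \<notin> G" by (simp add: G_def)
      ultimately have "G \<in> ?S" "p \<in> ?N G"
        using F unfolding FG by (auto simp: R_def forests_iff diverging_forest_insert_iff)
      then show "F \<in> ?h ` Sigma ?S ?N"
        using FG by force
    qed
  qed
  then have "(\<Sum>F\<in>?B. subgraph_weight w F * f F) =
    (\<Sum>z\<in>Sigma ?S ?N. subgraph_weight w (?h z) * f (?h z))"
    by (rule sum.reindex_bij_betw[symmetric])
  also have "\<dots> = (\<Sum>G\<in>?S. \<Sum>p\<in>?N G. subgraph_weight w (insert (p, i) G) * f (insert (p, i) G))"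
    by (subst sum.Sigma) (auto simp: split_def)
  also have "\<dots> = (\<Sum>G\<in>?S. \<Sum>p | (i, p) \<notin> G\<^sup>*. w p i * subgraph_weight w G * f (insert (p, i) G))"
  proof (rule sum.cong[OF refl])
    fix G assume "G \<in> ?S"
    then have "i \<in> roots G" by (simp add: R_def)
    then show "(\<Sum>p\<in>?N G. subgraph_weight w (insert (p, i) G) * f (insert (p, i) G)) =
        (\<Sum>p | (i, p) \<notin> G\<^sup>*. w p i * subgraph_weight w G * f (insert (p, i) G))"
      by (intro sum.mono_neutral_cong_left) (auto simp: subgraph_weight_insert arcs_def)
  qed
  finally show ?thesis using split by simp
qed

text \<open>The diagonal entry is the sum of the weights entering \<open>i\<close>, so row
  \<open>i\<close> acts as a weighted sum of differences. The term \<open>x = i\<close> vanishes,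
  which lets the sum run over all vertices.\<close>

lemma kirchhoff_matrix_mult_component:
  fixes w :: "'n::finite \<Rightarrow> 'n \<Rightarrow> real"
  shows "(kirchhoff_matrix w ** A) $ i $ j = (\<Sum>x\<in>UNIV. w x i * (A $ i $ j - A $ x $ j))"
proof -
  have "(kirchhoff_matrix w ** A) $ i $ j =
    (\<Sum>x\<in>UNIV - {i}. w x i) * A $ i $ j + (\<Sum>x\<in>UNIV - {i}. - w x i * A $ x $ j)"
    by (simp add: matrix_matrix_mult_def kirchhoff_matrix_def sum.remove[of UNIV i])
  also have "\<dots> = (\<Sum>x\<in>UNIV - {i}. w x i * (A $ i $ j - A $ x $ j))"
    by (simp add: sum_distrib_right right_diff_distrib sum_subtractf sum_negf)
  also have "\<dots> = (\<Sum>x\<in>UNIV. w x i * (A $ i $ j - A $ x $ j))"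
    by (simp add: sum.remove[of UNIV i])
  finally show ?thesis .
qed

text \<open>Entry \<open>(i, j)\<close> of the product sums \<open>?W F * ?g F\<close> over the
  forests with \<open>k\<close> arcs. Those in which \<open>i\<close> has a parent cancel; those in
  which \<open>i\<close> is a root turn, by adding an arc into \<open>i\<close>, into the forests
  with \<open>Suc k\<close> arcs in which \<open>i\<close> is not a root.\<close>

lemma forest_matrix_Suc:
  fixes w :: "'n::finite \<Rightarrow> 'n \<Rightarrow> real"
  shows "forest_matrix w (Suc k) =
    set_weight w (forests w (Suc k)) *\<^sub>R mat 1 - kirchhoff_matrix w ** forest_matrix w k"
proof (intro vec_eq_iff[THEN iffD2] allI)
  fix i j :: 'n
  let ?W = "subgraph_weight w"
  let ?R = "{G. G \<subseteq> arcs w \<and> diverging_forest G \<and> i \<in> roots G}"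
  let ?d = "of_bool (i = j) :: real"
  let ?g = "\<lambda>F. \<Sum>x\<in>UNIV. w x i * (rooted_at F i j - rooted_at F x j)"
  have "(kirchhoff_matrix w ** forest_matrix w k) $ i $ j =
    (\<Sum>x\<in>UNIV. \<Sum>F\<in>forests w k. ?W F * (w x i * (rooted_at F i j - rooted_at F x j)))"
    unfolding kirchhoff_matrix_mult_component forest_matrix_def
    by (simp add: set_weight_forests_to sum_distrib_left flip: sum_subtractf)
      (simp add: algebra_simps)
  also have "\<dots> = (\<Sum>F\<in>forests w k. ?W F * ?g F)"
    by (subst sum.swap) (simp add: sum_distrib_left)
  also have "\<dots> = (\<Sum>G\<in>{G \<in> ?R. card G = k}. ?W G * ?g G) +
    (\<Sum>G\<in>{G \<in> ?R. Suc (card G) = k}. \<Sum>p | (i, p) \<notin> G\<^sup>*. w p i * ?W G * ?g (insert (p, i) G))"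
    by (rule sum_forests_split)
  also have "(\<Sum>G\<in>{G \<in> ?R. Suc (card G) = k}. \<Sum>p | (i, p) \<notin> G\<^sup>*.
      w p i * ?W G * ?g (insert (p, i) G)) = 0"
  proof (rule sum.neutral, rule ballI)
    fix G assume "G \<in> {G \<in> ?R. Suc (card G) = k}"
    then have G: "diverging_forest G" "i \<in> roots G" by auto
    let ?N = "{p. (i, p) \<notin> G\<^sup>*}"
    let ?t = "\<lambda>p x. w p i * w x i * ?W G * rooted_at G p j"
    \<comment> \<open>Descendants of \<open>i\<close> share its root, which is now the root of
      \<open>p\<close>, so only \<open>x\<close> outside the tree of \<open>i\<close> contributes.
      The resulting double sum over \<open>p\<close> and \<open>x\<close> is antisymmetric and hence
      zero.\<close>
    have g: "?g (insert (p, i) G) = (\<Sum>x\<in>?N. w x i * (rooted_at G p j - rooted_at G x j))"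
      if "p \<in> ?N" for p
      using that by (intro sum.mono_neutral_cong_right) (auto simp: rooted_at_insert[OF G])
    have "(\<Sum>p\<in>?N. w p i * ?W G * ?g (insert (p, i) G)) =
      (\<Sum>p\<in>?N. w p i * ?W G * (\<Sum>x\<in>?N. w x i * (rooted_at G p j - rooted_at G x j)))"
      using g by (intro sum.cong) auto
    also have "\<dots> = (\<Sum>p\<in>?N. \<Sum>x\<in>?N. ?t p x - ?t x p)"
      unfolding sum_distrib_left by (intro sum.cong) (auto simp: algebra_simps)
    also have "\<dots> = (\<Sum>p\<in>?N. \<Sum>x\<in>?N. ?t p x) - (\<Sum>p\<in>?N. \<Sum>x\<in>?N. ?t x p)"
      by (simp add: sum_subtractf)
    also have "\<dots> = 0"
      by (subst (2) sum.swap) simp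
    finally show "(\<Sum>p\<in>?N. w p i * ?W G * ?g (insert (p, i) G)) = 0" .
  qed
  \<comment> \<open>Here \<open>i\<close> is its own root in \<open>G\<close>, whence
    \<open>?d\<close>, and the root of \<open>p\<close> in \<open>G\<close> is the root of
    \<open>i\<close> once \<open>(p, i)\<close> is added. Writing the size as \<open>Suc k\<close>
    prepares for splitting the sum over the larger forests.\<close>
  also have "(\<Sum>G\<in>{G \<in> ?R. card G = k}. ?W G * ?g G) =
    (\<Sum>G\<in>{G \<in> ?R. Suc (card G) = Suc k}. \<Sum>p | (i, p) \<notin> G\<^sup>*.
       w p i * ?W G * (?d - rooted_at (insert (p, i) G) i j))"
  proof (rule sum.cong)
    fix G assume "G \<in> {G \<in> ?R. Suc (card G) = Suc k}"
    then have G: "diverging_forest G" "i \<in> roots G" by auto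
    have "?g G = (\<Sum>p | (i, p) \<notin> G\<^sup>*. w p i * (?d - rooted_at (insert (p, i) G) i j))"
      by (intro sum.mono_neutral_cong_right)
        (auto simp: rooted_at_insert[OF G] rooted_at_descendant_of_root[OF G])
    then show "?W G * ?g G = (\<Sum>p | (i, p) \<notin> G\<^sup>*.
        w p i * ?W G * (?d - rooted_at (insert (p, i) G) i j))"
      by (simp add: sum_distrib_left algebra_simps)
  qed auto
  also have "\<dots> = (\<Sum>F\<in>forests w (Suc k). ?W F * (?d - rooted_at F i j))"
  proof -
    \<comment> \<open>The larger forests with root \<open>i\<close> can be added back freely,
      because there \<open>rooted_at G i j\<close> equals \<open>?d\<close>.\<close>
    have "(\<Sum>G\<in>{G \<in> ?R. card G = Suc k}. ?W G * (?d - rooted_at G i j)) = 0"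
      by (intro sum.neutral) (auto simp: rooted_at_descendant_of_root)
    then show ?thesis
      by (subst sum_forests_split[where i = i]) simp
  qed
  also have "\<dots> = ?d * set_weight w (forests w (Suc k)) - forest_matrix w (Suc k) $ i $ j"
    unfolding forest_matrix_def vec_lambda_beta set_weight_forests_to
    by (simp add: set_weight_def right_diff_distrib sum_subtractf)
  finally show "forest_matrix w (Suc k) $ i $ j =
    (set_weight w (forests w (Suc k)) *\<^sub>R mat 1 - kirchhoff_matrix w ** forest_matrix w k) $ i $ j"
    by (simp add: mat_def)
qed

lemma forests_0:
  fixes w :: "'n::finite \<Rightarrow> 'n \<Rightarrow> real"
  shows "forests w 0 = {{}}"
  by (auto simp: forests_iff diverging_forest_iff acyclic_def)

lemma forest_matrix_0:
  fixes w :: "'n::finite \<Rightarrow> 'n \<Rightarrow> real"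
  shows "forest_matrix w 0 = set_weight w (forests w 0) *\<^sub>R mat 1"
proof -
  have "set_weight w (forests w 0) = 1"
    by (simp add: forests_0 set_weight_def subgraph_weight_def)
  then show ?thesis
    by (auto simp: vec_eq_iff forest_matrix_def set_weight_forests_to forests_0
        subgraph_weight_def rooted_at_def roots_iff mat_def)
qed

lemma normalized_max_forest_matrix_properties:
  fixes w :: "'n::finite \<Rightarrow> 'n \<Rightarrow> real"
  assumes w: "weighted_digraph w"
  shows "kirchhoff_matrix w ** normalized_max_forest_matrix w = 0"
    and "\<exists>R. normalized_max_forest_matrix w = mat 1 - kirchhoff_matrix w ** R"
proof -
  define m where "m = CARD('n) - forest_dimension w"
  define s where "s = set_weight w (forests w m)"
  have max: "forests w m = maximum_out_forests w"
    by (simp add: m_def forests_max)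
  have J: "normalized_max_forest_matrix w = (1 / s) *\<^sub>R forest_matrix w m"
    by (simp add: normalized_max_forest_matrix_def m_def s_def Let_def)
  have "subgraph_weight w F > 0" if "F \<subseteq> arcs w" for F
    using w that unfolding subgraph_weight_def weighted_digraph_def by (intro prod_pos) auto
  then have s: "s > 0"
    unfolding s_def set_weight_def using maximum_out_forests_nonempty[of w]
    by (intro sum_pos) (auto simp: max[symmetric] forests_iff)
  obtain M where M: "M \<in> maximum_out_forests w"
    using maximum_out_forests_nonempty by blast
  have "card F \<le> m" if "F \<in> spanning_diverging_forests w" for F
  proof -
    have "card M = m" using M unfolding max[symmetric] by (simp add: forests_iff)
    then show ?thesis using M that by (auto simp: maximum_out_forests_def)
  qed
  then have empty: "forests w (Suc m) = {}"
    by (fastforce simp: forests_def)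
  then have "forest_matrix w (Suc m) = 0"
    by (simp add: vec_eq_iff forest_matrix_def set_weight_forests_to)
  with empty show "kirchhoff_matrix w ** normalized_max_forest_matrix w = 0"
    using forest_matrix_Suc[of w m] by (simp add: J set_weight_def matrix_mult_scaleR_right)
  show "\<exists>R. normalized_max_forest_matrix w = mat 1 - kirchhoff_matrix w ** R"
  \<comment> \<open>For \<open>m = 0\<close> the recurrence has no preceding index; the only forest
    is then empty, and \<open>0\<close> serves as the witness.\<close>
  proof (cases m)
    case 0
    then have "normalized_max_forest_matrix w = mat 1 - kirchhoff_matrix w ** 0"
      using s by (simp add: J forest_matrix_0 s_def)
    then show ?thesis ..
  next
    case (Suc k)
    then have "normalized_max_forest_matrix w =
        mat 1 - kirchhoff_matrix w ** ((1 / s) *\<^sub>R forest_matrix w k)"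
      using s by (simp add: J forest_matrix_Suc s_def scaleR_diff_right matrix_mult_scaleR_right)
    then show ?thesis ..
  qed
qed

section \<open>Cesaro means of stochastic matrices\<close>

lemma stochastic_matrix_power:
  assumes "stochastic_matrix P"
  shows "stochastic_matrix (matrix_power P k)"
proof (induction k)
  case 0
  show ?case by (auto simp: stochastic_matrix_def mat_def)
next
  case (Suc k)
  have "(\<Sum>j\<in>UNIV. \<Sum>l\<in>UNIV. P $ i $ l * matrix_power P k $ l $ j) = 1" for i
    by (subst sum.swap)
      (use assms Suc in \<open>simp add: stochastic_matrix_def flip: sum_distrib_left\<close>)
  then show ?case
    using assms Suc by (auto simp: stochastic_matrix_def matrix_matrix_mult_def intro!: sum_nonneg)
qed

lemma stochastic_matrix_le_1:
  assumes "stochastic_matrix P"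
  shows "P $ i $ j \<le> 1"
  using assms member_le_sum[of j UNIV "\<lambda>j. P $ i $ j"] by (simp add: stochastic_matrix_def)

lemma sum_matrix_power_telescope:
  "(\<Sum>t<k. matrix_power P t) ** (mat 1 - P) = mat 1 - matrix_power P k"
proof (induction k)
  case (Suc k)
  \<comment> \<open>\<open>matrix_power\<close> multiplies by \<open>P\<close> on the left, whereas
    the telescoping factor stands on the right.\<close>
  have commute: "matrix_power P k ** P = P ** matrix_power P k" for k
    by (induction k) (simp_all add: matrix_mul_assoc[symmetric])
  have "(\<Sum>t<Suc k. matrix_power P t) ** (mat 1 - P) =
      mat 1 - matrix_power P k + matrix_power P k ** (mat 1 - P)"
    by (simp add: matrix_mult_add_left Suc)
  also have "\<dots> = mat 1 - matrix_power P (Suc k)"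
    by (simp add: matrix_mult_diff_right commute)
  finally show ?case .
qed simp

lemma cesaro_mean_tendsto:
  assumes P: "stochastic_matrix P" and PJ: "P ** J = J" and J: "J = mat 1 - (mat 1 - P) ** R"
  shows "cesaro_mean P \<longlonglongrightarrow> J"
proof -
  have "matrix_power P t ** J = J" for t
    by (induction t) (simp_all add: PJ matrix_mul_assoc[symmetric])
  then have sum_J: "(\<Sum>t<k. matrix_power P t) ** J = real k *\<^sub>R J" for k
    by (induction k) (simp_all add: matrix_mult_add_left scaleR_left_distrib)
  \<comment> \<open>At \<open>k = 0\<close> the mean is \<open>0\<close> because
    \<open>1 / 0 = 0\<close>, so the identity is stated for positive \<open>k\<close> only.\<close>
  have eq: "cesaro_mean P k = J + (1 / real k) *\<^sub>R ((mat 1 - matrix_power P k) ** R)"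
    if "k > 0" for k
  proof -
    have "(\<Sum>t<k. matrix_power P t) = (\<Sum>t<k. matrix_power P t) ** (J + (mat 1 - P) ** R)"
      by (simp add: J)
    also have "\<dots> = real k *\<^sub>R J + (mat 1 - matrix_power P k) ** R"
      by (simp add: matrix_add_ldistrib sum_J matrix_mul_assoc sum_matrix_power_telescope)
    finally show ?thesis
      using that by (simp add: cesaro_mean_def scaleR_right_distrib)
  qed
  have "(\<lambda>k. (1 / real k) *\<^sub>R ((mat 1 - matrix_power P k) ** R)) \<longlonglongrightarrow> 0"
  proof (intro vec_tendstoI)
    fix i j
    \<comment> \<open>The entries of \<open>mat 1 - matrix_power P k\<close> lie between -1 and 1,
      so the absolute column sum of \<open>R\<close> is a bound uniform in \<open>k\<close>.\<close>
    let ?C = "\<Sum>l\<in>UNIV. \<bar>R $ l $ j\<bar>"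
    have bound: "\<bar>((mat 1 - matrix_power P k) ** R) $ i $ j\<bar> \<le> ?C" for k
    proof -
      have "\<bar>(mat 1 - matrix_power P k) $ i $ l\<bar> \<le> 1" for l
        using stochastic_matrix_power[OF P, of k] stochastic_matrix_le_1[of "matrix_power P k" i l]
        by (auto simp: stochastic_matrix_def mat_def abs_le_iff intro: order_trans[of _ 0])
      then have "\<bar>(mat 1 - matrix_power P k) $ i $ l * R $ l $ j\<bar> \<le> \<bar>R $ l $ j\<bar>" for l
        by (simp add: abs_mult mult_left_le_one_le)
      then have "(\<Sum>l\<in>UNIV. \<bar>(mat 1 - matrix_power P k) $ i $ l * R $ l $ j\<bar>) \<le> ?C"
        by (intro sum_mono)
      then show ?thesis
        unfolding matrix_matrix_mult_def by (simp add: order_trans[OF sum_abs])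
    qed
    have "(\<lambda>k. ((1 / real k) *\<^sub>R ((mat 1 - matrix_power P k) ** R)) $ i $ j) \<longlonglongrightarrow> 0"
    proof (rule Lim_null_comparison[OF _ lim_const_over_n[of ?C]])
      show "\<forall>\<^sub>F k in sequentially.
          norm (((1 / real k) *\<^sub>R ((mat 1 - matrix_power P k) ** R)) $ i $ j) \<le> ?C / real k"
        using bound by (intro always_eventually) (simp add: abs_mult divide_right_mono)
    qed
    then show "(\<lambda>k. ((1 / real k) *\<^sub>R ((mat 1 - matrix_power P k) ** R)) $ i $ j)
        \<longlonglongrightarrow> (0::real ^ 'a ^ 'a) $ i $ j"
      by simp
  qed
  from tendsto_add[OF tendsto_const[of J] this]
  have "(\<lambda>k. J + (1 / real k) *\<^sub>R ((mat 1 - matrix_power P k) ** R)) \<longlonglongrightarrow> J"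
    by simp
  then show ?thesis
    by (rule Lim_transform_eventually) (auto simp: eq intro!: eventually_sequentiallyI[of 1])
qed

theorem theorem7:
  fixes w :: "'n::finite \<Rightarrow> 'n \<Rightarrow> real"
    and P :: "real ^ 'n ^ 'n"
    and \<alpha> :: real
  assumes "CARD('n) > 1"
    and "weighted_digraph w"
    and "stochastic_matrix P"
    and "\<alpha> \<noteq> 0"
    and "P = mat 1 - \<alpha> *\<^sub>R kirchhoff_matrix w"
  shows "cesaro_mean P \<longlonglongrightarrow> normalized_max_forest_matrix w"
proof -
  let ?J = "normalized_max_forest_matrix w"
  obtain R where R: "?J = mat 1 - kirchhoff_matrix w ** R"
    using normalized_max_forest_matrix_properties(2)[OF assms(2)] by blast
  show ?thesis
  proof (rule cesaro_mean_tendsto[OF assms(3)])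
    show "P ** ?J = ?J"
      using normalized_max_forest_matrix_properties(1)[OF assms(2)]
      by (simp add: assms(5) matrix_mult_diff_left matrix_mult_scaleR_left)
    \<comment> \<open>The factor \<open>1 / \<alpha>\<close> compensates for
      \<open>mat 1 - P\<close> being \<alpha> times the Kirchhoff matrix.\<close>
    show "?J = mat 1 - (mat 1 - P) ** ((1 / \<alpha>) *\<^sub>R R)"
      using assms(4) by (simp add: assms(5) R matrix_mult_scaleR_left matrix_mult_scaleR_right)
  qed
qed

end
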